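(* Let $r\geq 1$ be an integer. For every real $s$ with $0\leq s<1/r$, the value $\zeta_r(s)$ is positive if $r$ is even and negative if $r$ is odd. In particular, $\zeta_r(s)$ has no zero in the interval $[0,1/r)$.
   Context: For an integer $r\geq 1$, $\zeta_r(s)=\zeta_r(s,s,\ldots,s)$ denotes the Euler–Zagier $r$-fold zeta-function with all $r$ arguments equal to $s$, i.e. the meromorphic continuation to $\mathbb{C}$ of $\sum_{1\leq m_1<m_2<\cdots<m_r}(m_1m_2\cdots m_r)^{-s}$ (absolutely convergent for $\Re s>1$). In particular $\zeta_1(s)=\zeta(s)$ is the Riemann zeta-function. *)

theory Defs
  imports "HOL-Complex_Analysis.Complex_Analysis"
begin

text \<open>A tuple \<open>1 \<le> m\<^sub>1 < \<dots> < m\<^sub>r\<close> is the strictly increasing list \<open>[m\<^sub>1, \<dots>, m\<^sub>r]\<close>.\<close>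

definition ez_tuples :: "nat \<Rightarrow> nat list set" where
  "ez_tuples r = {ms. length ms = r \<and> sorted_wrt (<) ms \<and> (\<forall>m\<in>set ms. 1 \<le> m)}"

definition ez_series :: "nat \<Rightarrow> complex \<Rightarrow> complex" where
  "ez_series r s = (\<Sum>\<^sub>\<infinity>ms\<in>ez_tuples r. of_nat (prod_list ms) powr (- s))"

text \<open>
  Meromorphic functions are total here. Requiring \<^const>\<open>nicely_meromorphic_on\<close> fixes their
  values: the continuous value at every point that is not a pole, and \<open>0\<close> at every pole.
  This makes the continuation unique as a function.
\<close>

definition is_ez_continuation :: "nat \<Rightarrow> (complex \<Rightarrow> complex) \<Rightarrow> bool" where
  "is_ez_continuation r f \<longleftrightarrow>
     f nicely_meromorphic_on UNIV \<and> (\<forall>s. 1 < Re s \<longrightarrow> f s = ez_series r s)"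

definition ez_zeta :: "nat \<Rightarrow> complex \<Rightarrow> complex" where
  "ez_zeta r = (THE f. is_ez_continuation r f)"

lemma is_ez_continuation_unique:
  assumes "is_ez_continuation r f" "is_ez_continuation r g"
  shows "f = g"
proof
  fix z
  have f: "f nicely_meromorphic_on UNIV" and g: "g nicely_meromorphic_on UNIV"
    using assms by (auto simp: is_ez_continuation_def)
  define d where "d = (\<lambda>z. f z - g z)"
  have d: "d meromorphic_on UNIV"
    using f g unfolding d_def nicely_meromorphic_on_def by (auto intro!: meromorphic_intros)
  define h where "h = remove_sings d"
  have h: "h nicely_meromorphic_on UNIV"
    unfolding h_def using d by (rule remove_sings_nicely_meromorphic)
  have opn: "open {s. 1 < Re s}" by (rule open_halfspace_Re_gt)
  have d0: "d s = 0" if "1 < Re s" for s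
    using assms that by (simp add: d_def is_ez_continuation_def)
  have h0: "h s = 0" if "1 < Re s" for s
  proof -
    have "\<forall>\<^sub>F w in at s. d w = 0"
      using opn that d0 by (auto simp: eventually_at_topological)
    then have "d \<midarrow>s\<rightarrow> 0" by (simp add: tendsto_eventually)
    then show ?thesis unfolding h_def by (rule remove_sings_eqI)
  qed
  have "\<forall>\<^sub>F w in at 2. h w = 0"
    using opn h0 by (auto simp: eventually_at_topological intro!: exI[of _ "{s. 1 < Re s}"])
  then have fr: "\<exists>\<^sub>F w in at 2. h w = 0" by (simp add: eventually_frequently)
  have hz: "h w = 0" for w
    by (rule frequently_eq_meromorphic_imp_constant[OF fr h open_UNIV connected_UNIV]) simp_all
  have "\<forall>\<^sub>F w in at z. remove_sings d w = d w"
    using d by (intro eventually_remove_sings_eq_at meromorphic_on_isolated_singularity)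
      (auto intro: meromorphic_on_subset)
  then have ev: "\<forall>\<^sub>F w in at z. f w = g w"
    by eventually_elim (use hz in \<open>simp add: h_def d_def\<close>)
  have pole: "is_pole f z \<longleftrightarrow> is_pole g z"
    by (rule is_pole_cong[OF ev refl])
  have lim: "f \<midarrow>z\<rightarrow> c \<longleftrightarrow> g \<midarrow>z\<rightarrow> c" for c
    by (rule tendsto_cong[OF ev])
  have "(is_pole f z \<and> f z = 0) \<or> f \<midarrow>z\<rightarrow> f z" "(is_pole g z \<and> g z = 0) \<or> g \<midarrow>z\<rightarrow> g z"
    using f g by (auto simp: nicely_meromorphic_on_def)
  moreover have "\<not> (is_pole f z \<and> f \<midarrow>z\<rightarrow> c)" for c
    using not_tendsto_and_filterlim_at_infinity[of "at z" f c] by (auto simp: is_pole_def)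
  ultimately show "f z = g z"
    using pole lim LIM_unique[of f "f z" z "g z"] by auto
qed

end

theory Submission
  imports Defs
begin

text \<open>
  The value \<open>\<zeta>\<^sub>r(s)\<close> is the \<open>r\<close>-th elementary symmetric function of the numbers
  \<open>m powr (- s)\<close>, whose power sums are \<open>\<zeta>(k s)\<close>. Newton's identities
  \<open>r \<zeta>\<^sub>r(s) = (\<Sum>k=1..r. (- 1) ^ (k - 1) * \<zeta>\<^sub>r\<^sub>-\<^sub>k(s) * \<zeta>(k s))\<close> therefore hold for \<open>Re s > 1\<close>,
  and they continue \<open>\<zeta>\<^sub>r\<close> meromorphically once \<open>\<zeta>\<close> is continued. For \<open>0 \<le> s < 1 / r\<close> all
  arguments \<open>k s\<close> lie in \<open>[0, 1)\<close>, where \<open>\<zeta>\<close> is negative, so by induction every term of the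
  sum for \<open>(- 1) ^ r * \<zeta>\<^sub>r(s)\<close> is positive.

  The continuation of \<open>\<zeta>\<close> and its sign come from the alternating series
  \<open>\<eta>(s) = (1 - 2 powr (1 - s)) \<zeta>(s)\<close>: averaging the series with its shift \<open>j\<close> times replaces
  \<open>m powr (- s)\<close> by its \<open>j\<close>-th difference, which is \<open>O(m powr (- Re s - j))\<close>, so that \<open>\<eta>\<close> is
  entire. On \<open>[0, \<infinity>)\<close> the case \<open>j = 2\<close> and the convexity of \<open>m powr (- s)\<close> give \<open>\<eta> > 0\<close>.
\<close>

subsection \<open>The Dirichlet eta function and the continuation of zeta\<close>

text \<open>
  The sign \<open>(- 1) ^ j\<close> of the usual forward difference is absorbed, so that
  differencing the alternating series termwise amounts to averaging it with its shift.
\<close>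

fun powr_fdiff :: "nat \<Rightarrow> complex \<Rightarrow> real \<Rightarrow> complex" where
  "powr_fdiff 0 s x = of_real x powr (- s)"
| "powr_fdiff (Suc j) s x = powr_fdiff j s x - powr_fdiff j s (x + 1)"

text \<open>Differentiation in \<open>x\<close> commutes with differencing and turns exponent
  \<open>- s\<close> into \<open>- (s + 1)\<close>. This shift is the source of the decay gained
  with each difference.\<close>

lemma powr_fdiff_has_vector_derivative:
  assumes "x > 0"
  shows "(powr_fdiff j s has_vector_derivative (- s * powr_fdiff j (s + 1) x)) (at x)"
  using assms
proof (induction j arbitrary: x)
  case 0
  have "((\<lambda>z. z powr (- s)) has_field_derivative (- s * of_real x powr (- s - 1)))
          (at (complex_of_real x))"
    using 0 by (intro has_field_derivative_powr) (auto simp: complex_nonpos_Reals_iff)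
  then have "((\<lambda>x. complex_of_real x powr (- s)) has_vector_derivative
               (- s * of_real x powr (- s - 1))) (at x)"
    by (rule has_vector_derivative_real_field)
  moreover have "- s - 1 = - (s + 1)"
    by simp
  ultimately show ?case
    by (metis (no_types, lifting) ext powr_fdiff.simps(1))
next
  case (Suc j)
  have "((powr_fdiff j s \<circ> (\<lambda>x. x + 1)) has_vector_derivative
          (1 *\<^sub>R (- s * powr_fdiff j (s + 1) (x + 1)))) (at x)"
    using Suc.prems
    by (intro vector_diff_chain_at Suc.IH) (auto intro!: derivative_eq_intros)
  then have "((\<lambda>x. powr_fdiff j s x - powr_fdiff j s (x + 1)) has_vector_derivative
          (- s * powr_fdiff j (s + 1) x - - s * powr_fdiff j (s + 1) (x + 1))) (at x)"
    by (intro has_vector_derivative_diff Suc.IH Suc.prems) (simp_all add: o_def)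
  then show ?case
    by (simp add: algebra_simps)
qed

lemma pochhammer_mono:
  fixes a b :: real
  assumes "0 \<le> a" "a \<le> b"
  shows "pochhammer a n \<le> pochhammer b n"
  unfolding pochhammer_prod using assms by (intro prod_mono) auto

text \<open>The mean value inequality trades one difference for a derivative, hence for a factor
  \<open>s\<close> and a shift to \<open>s + 1\<close>; the factors collect into the Pochhammer
  symbol. The condition on \<open>Re s + real j\<close> makes the final power of \<open>x\<close>
  decreasing, so the intermediate point \<open>y > x\<close> can be replaced by
  \<open>x\<close>.\<close>

lemma norm_powr_fdiff_le:
  assumes "x > 0" "Re s + real j \<ge> 0"
  shows "norm (powr_fdiff j s x) \<le> pochhammer (norm s) j * x powr (- Re s - real j)"
  using assms
proof (induction j arbitrary: s x)
  case 0
  then show ?case by (simp add: norm_powr_real_powr)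
next
  case (Suc j)
  have "continuous_on {x..x+1} (powr_fdiff j s)"
    using Suc.prems
    by (intro continuous_at_imp_continuous_on ballI
        has_vector_derivative_continuous[OF powr_fdiff_has_vector_derivative]) auto
  then have "\<exists>y\<in>{x<..<x+1}. norm (powr_fdiff j s (x + 1) - powr_fdiff j s x)
          \<le> norm ((x + 1 - x) *\<^sub>R (- s * powr_fdiff j (s + 1) y))"
    using Suc.prems powr_fdiff_has_vector_derivative[of _ j s]
    by (intro mvt_general) (auto simp: has_vector_derivative_def)
  then obtain y where y: "x < y"
    "norm (powr_fdiff j s (x + 1) - powr_fdiff j s x) \<le> norm s * norm (powr_fdiff j (s + 1) y)"
    by (auto simp: norm_mult)
  have "norm (powr_fdiff (Suc j) s x) \<le> norm s * norm (powr_fdiff j (s + 1) y)"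
    using y(2) by (simp add: norm_minus_commute)
  also have "norm (powr_fdiff j (s + 1) y)
      \<le> pochhammer (norm (s + 1)) j * y powr (- Re (s + 1) - real j)"
    using Suc.prems y by (intro Suc.IH) auto
  also have "\<dots> \<le> pochhammer (norm s + 1) j * x powr (- Re s - real (Suc j))"
  proof (intro mult_mono pochhammer_mono)
    show "norm (s + 1) \<le> norm s + 1"
      using norm_triangle_ineq[of s 1] by simp
    have "- Re (s + 1) - real j = - Re s - real (Suc j)"
      by simp
    then show "y powr (- Re (s + 1) - real j) \<le> x powr (- Re s - real (Suc j))"
      using Suc.prems y by (simp only:) (intro powr_mono2', auto)
  qed (auto intro!: pochhammer_nonneg add_nonneg_pos)
  finally show ?case
    by (simp add: pochhammer_rec mult_left_mono mult.assoc)
qed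

lemma holomorphic_powr_fdiff:
  assumes "x > 0"
  shows "(\<lambda>s. powr_fdiff j s x) holomorphic_on A"
  using assms by (induction j arbitrary: x) (auto intro!: holomorphic_intros)

lemma summable_Suc_powr:
  fixes a :: real
  assumes "a < -1"
  shows "summable (\<lambda>n. (real n + 1) powr a)"
  using assms summable_Suc_iff[of "\<lambda>n. real n powr a"]
  by (simp add: summable_real_powr_iff add.commute)

lemma summable_powr_fdiff:
  assumes "Re s + real j > 1"
  shows "summable (\<lambda>n. (- 1) ^ n * powr_fdiff j s (real n + 1))"
proof (rule summable_comparison_test')
  show "summable (\<lambda>n. pochhammer (norm s) j * (real n + 1) powr (- Re s - real j))"
    using assms by (intro summable_mult summable_Suc_powr) auto
  show "norm ((- 1) ^ n * powr_fdiff j s (real n + 1))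
      \<le> pochhammer (norm s) j * (real n + 1) powr (- Re s - real j)" for n
    using assms norm_powr_fdiff_le[of "real n + 1" s j] by (simp add: norm_mult norm_power)
qed

definition eta_tail :: "nat \<Rightarrow> complex \<Rightarrow> complex" where
  "eta_tail j s = (\<Sum>n. (- 1) ^ n * powr_fdiff j s (real n + 1))"

lemma holomorphic_eta_tail: "eta_tail j holomorphic_on {s. Re s + real j > 1}"
proof (rule holomorphic_uniform_sequence)
  have "{s. Re s + real j > 1} = {s. Re s > 1 - real j}"
    by auto
  then show "open {s. Re s + real j > 1}"
    using open_halfspace_Re_gt by metis
  show "(\<lambda>s. \<Sum>n<N. (- 1) ^ n * powr_fdiff j s (real n + 1)) holomorphic_on
          {s. Re s + real j > 1}" for N
    by (intro holomorphic_intros holomorphic_powr_fdiff) auto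
  fix z assume z: "z \<in> {s. Re s + real j > 1}"
  \<comment> \<open>Half the distance from \<open>z\<close> to the line Re s = 1 - j. On the closed
    disc the exponents \<open>- Re s - real j\<close> are then at most -1 - d, which gives a
    summable majorant.\<close>
  define d where "d = (Re z + real j - 1) / 2"
  have "d > 0" using z by (simp add: d_def)
  have d: "Re s \<ge> Re z - d" "norm s \<le> norm z + d" if "s \<in> cball z d" for s
  proof -
    have "norm (z - s) \<le> d"
      using that by (simp add: dist_norm)
    then show "Re s \<ge> Re z - d"
      using complex_Re_le_cmod[of "z - s"] by simp
    show "norm s \<le> norm z + d"
      using \<open>norm (z - s) \<le> d\<close> norm_triangle_sub[of s z] by (simp add: norm_minus_commute)
  qed
  have "uniform_limit (cball z d)
      (\<lambda>N s. \<Sum>n<N. (- 1) ^ n * powr_fdiff j s (real n + 1)) (eta_tail j) sequentially"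
    unfolding eta_tail_def
  proof (rule Weierstrass_m_test)
    show "summable (\<lambda>n. pochhammer (norm z + d) j * (real n + 1) powr (- (Re z - d) - real j))"
      using z by (intro summable_mult summable_Suc_powr) (auto simp: d_def field_simps)
    fix n s assume s: "s \<in> cball z d"
    have "Re s + real j \<ge> 0"
      using d[OF s] z by (auto simp: d_def field_simps)
    then have "norm ((- 1) ^ n * powr_fdiff j s (real n + 1))
        \<le> pochhammer (norm s) j * (real n + 1) powr (- Re s - real j)"
      using norm_powr_fdiff_le[of "real n + 1" s j] by (simp add: norm_mult norm_power)
    also have "\<dots> \<le> pochhammer (norm z + d) j * (real n + 1) powr (- (Re z - d) - real j)"
      using d[OF s] \<open>d > 0\<close>
      by (intro mult_mono pochhammer_mono powr_mono pochhammer_nonneg)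
        (auto intro!: add_nonneg_pos)
    finally show "norm ((- 1) ^ n * powr_fdiff j s (real n + 1))
      \<le> pochhammer (norm z + d) j * (real n + 1) powr (- (Re z - d) - real j)" .
  qed
  moreover have "cball z d \<subseteq> {s. Re s + real j > 1}"
  proof
    fix s assume "s \<in> cball z d"
    then have "Re s \<ge> Re z - d"
      by (rule d(1))
    with z show "s \<in> {s. Re s + real j > 1}"
      by (simp add: d_def field_simps)
  qed
  ultimately show "\<exists>d>0. cball z d \<subseteq> {s. Re s + real j > 1} \<and> uniform_limit (cball z d)
      (\<lambda>N s. \<Sum>n<N. (- 1) ^ n * powr_fdiff j s (real n + 1)) (eta_tail j) sequentially"
    using \<open>d > 0\<close> by blast
qed

text \<open>Adding the series to its shift combines neighbouring terms of opposite sign into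
  differences of the next order; the shift lacks only the first term.\<close>

lemma eta_tail_Suc:
  assumes "Re s + real j > 1"
  shows "2 * eta_tail j s = powr_fdiff j s 1 + eta_tail (Suc j) s"
proof -
  define a where "a = (\<lambda>n. (- 1) ^ n * powr_fdiff j s (real n + 1))"
  have a: "summable a"
    using summable_powr_fdiff[OF assms] by (simp add: a_def)
  then have a': "summable (\<lambda>n. a (Suc n))"
    by (simp add: summable_Suc_iff)
  have "eta_tail (Suc j) s = (\<Sum>n. a n + a (Suc n))"
    unfolding eta_tail_def by (rule suminf_cong) (simp add: a_def algebra_simps)
  also have "\<dots> = suminf a + (suminf a - a 0)"
    using a a' by (simp add: suminf_add [symmetric] suminf_split_head)
  finally show ?thesis
    by (simp add: eta_tail_def a_def)
qed

text \<open>Obtained from \<open>eta_tail 0\<close> by \<open>j\<close> applications of the preceding identity.\<close>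

definition eta_ext :: "nat \<Rightarrow> complex \<Rightarrow> complex" where
  "eta_ext j s = (\<Sum>i<j. powr_fdiff i s 1 / 2 ^ Suc i) + eta_tail j s / 2 ^ j"

lemma holomorphic_eta_ext: "eta_ext j holomorphic_on {s. Re s + real j > 1}"
  unfolding eta_ext_def
  by (intro holomorphic_intros holomorphic_powr_fdiff holomorphic_eta_tail) auto

text \<open>Raising the order only rewrites the tail by \<open>eta_tail_Suc\<close>, so the value
  persists wherever the lower order converges.\<close>

lemma eta_ext_eq:
  assumes "Re s + real j > 1" "j \<le> k"
  shows "eta_ext k s = eta_ext j s"
  using \<open>j \<le> k\<close>
proof (induction rule: dec_induct)
  case (step n)
  have "2 * eta_tail n s = powr_fdiff n s 1 + eta_tail (Suc n) s"
    using assms step.hyps by (intro eta_tail_Suc) linarith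
  then have "eta_tail n s = (powr_fdiff n s 1 + eta_tail (Suc n) s) / 2"
    by (simp add: mult.commute)
  with step.IH show ?case
    by (simp add: eta_ext_def add_divide_distrib add.assoc)
qed simp

text \<open>No single order serves the whole plane. The order chosen here satisfies Re s + j \<ge>
  2, and by \<open>eta_eq_eta_ext\<close> every order with Re s + j > 1 gives the same
  value.\<close>

definition eta :: "complex \<Rightarrow> complex" where
  "eta s = eta_ext (nat \<lceil>\<bar>Re s\<bar>\<rceil> + 2) s"

lemma eta_eq_eta_ext:
  assumes "Re s + real j > 1"
  shows "eta s = eta_ext j s"
proof -
  let ?k = "nat \<lceil>\<bar>Re s\<bar>\<rceil> + 2"
  have "Re s + real ?k > 1"
    by linarith
  then have "eta_ext (max j ?k) s = eta s"
    unfolding eta_def by (intro eta_ext_eq) auto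
  moreover have "eta_ext (max j ?k) s = eta_ext j s"
    using assms by (intro eta_ext_eq) auto
  ultimately show ?thesis
    by simp
qed

lemma holomorphic_eta: "eta holomorphic_on A"
proof -
  have "eta holomorphic_on (\<Union>j. {s. Re s + real j > 1})"
  proof (rule holomorphic_on_UN_open)
    fix j :: nat
    have "{s. Re s + real j > 1} = {s. Re s > 1 - real j}"
      by auto
    then show "open {s. Re s + real j > 1}"
      using open_halfspace_Re_gt by metis
    show "eta holomorphic_on {s. Re s + real j > 1}"
      using holomorphic_eta_ext by (rule holomorphic_transform) (simp add: eta_eq_eta_ext)
  qed
  moreover have "s \<in> (\<Union>j. {s. Re s + real j > 1})" for s
    using reals_Archimedean2[of "1 - Re s"] by (auto simp: algebra_simps)
  ultimately show ?thesis
    by (meson holomorphic_on_subset subsetI)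
qed

section \<open>Positivity of eta on the nonnegative real axis\<close>

text \<open>From (x + 1)^2 \<ge> x (x + 2) the middle value is at most the geometric mean of the
  outer two, hence at most their arithmetic mean.\<close>

lemma convex_powr_neg:
  fixes x a :: real
  assumes "x > 0" "a \<ge> 0"
  shows "2 * (x + 1) powr (- a) \<le> x powr (- a) + (x + 2) powr (- a)"
proof -
  let ?u = "x powr (- a / 2)" and ?v = "(x + 2) powr (- a / 2)"
  have "(x + 1) powr (- a) = ((x + 1) * (x + 1)) powr (- a / 2)"
    using assms by (simp add: powr_mult powr_add [symmetric])
  also have "\<dots> \<le> (x * (x + 2)) powr (- a / 2)"
    using assms by (intro powr_mono2' mult_pos_pos) (auto simp: algebra_simps)
  also have "\<dots> = ?u * ?v"
    using assms by (simp add: powr_mult)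
  finally have "2 * (x + 1) powr (- a) \<le> ?u\<^sup>2 + ?v\<^sup>2"
    using sum_squares_bound[of ?u ?v] by simp
  then show ?thesis
    by (simp add: power2_eq_square powr_add [symmetric])
qed

text \<open>At order 2 the value is 1/2 plus a quarter of \<open>d1 0\<close> plus a quarter of an
  alternating sum of nonnegative second differences. That sum is at least \<open>- d1 0\<close>, so
  the value is at least 1/2.\<close>

lemma eta_of_real_pos:
  assumes "0 \<le> x"
  obtains c where "c > 0" "eta (complex_of_real x) = of_real c"
proof -
  define d1 where "d1 = (\<lambda>n. (real n + 1) powr (- x) - (real n + 2) powr (- x))"
  define d2 where "d2 = (\<lambda>n. d1 n - d1 (Suc n))"
  have pow: "complex_of_real y powr (- of_real x) = of_real (y powr (- x))" if "y > 0" for y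
    using that powr_of_real[of y "- x"] by simp
  have D1: "powr_fdiff 1 (of_real x) (real n + 1) = of_real (d1 n)" for n
    using pow[of "real n + 1"] pow[of "real n + 2"] by (simp add: d1_def add_ac)
  have D2: "powr_fdiff 2 (of_real x) (real n + 1) = of_real (d2 n)" for n
    using D1[of n] D1[of "Suc n"] by (simp add: d2_def eval_nat_numeral add_ac)
  have d2_nonneg: "d2 n \<ge> 0" for n
    using convex_powr_neg[of "real n + 1" x] assms by (simp add: d2_def d1_def add_ac)
  have d1_nonneg: "d1 n \<ge> 0" for n
    using assms by (simp add: d1_def powr_mono2')
  have "summable (\<lambda>n. complex_of_real ((- 1) ^ n * d2 n))"
    using summable_powr_fdiff[of "of_real x" 2] assms D2 by simp
  then have sm: "summable (\<lambda>n. (- 1) ^ n * d2 n)"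
    by (simp only: summable_complex_of_real)
  have "eta_tail 2 (of_real x) = (\<Sum>n. complex_of_real ((- 1) ^ n * d2 n))"
    unfolding eta_tail_def D2 by simp
  also have "\<dots> = of_real (\<Sum>n. (- 1) ^ n * d2 n)"
    using sm by (rule suminf_of_real [symmetric])
  finally have tail: "eta_tail 2 (of_real x) = of_real (\<Sum>n. (- 1) ^ n * d2 n)" .
  \<comment> \<open>Replacing every sign by -1 is a crude lower bound, but the resulting sum
    telescopes.\<close>
  have "- d1 0 \<le> (\<Sum>n<N. (- 1) ^ n * d2 n)" for N
  proof -
    have "- d1 0 \<le> d1 N - d1 0"
      using d1_nonneg[of N] by simp
    also have "\<dots> = (\<Sum>n<N. - d2 n)"
      by (induction N) (auto simp: d2_def)
    also have "\<dots> \<le> (\<Sum>n<N. (- 1) ^ n * d2 n)"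
    proof (rule sum_mono)
      show "- d2 n \<le> (- 1) ^ n * d2 n" for n
        using d2_nonneg[of n] by (cases "even n") auto
    qed
    finally show ?thesis .
  qed
  then have lower: "- d1 0 \<le> (\<Sum>n. (- 1) ^ n * d2 n)"
    by (intro LIMSEQ_le_const[OF summable_LIMSEQ[OF sm]]) auto
  define c where "c = 1 / 2 + d1 0 / 4 + (\<Sum>n. (- 1) ^ n * d2 n) / 4"
  \<comment> \<open>Order 2 includes the endpoint x = 0, where order 1 just fails the convergence
    condition.\<close>
  have "eta (of_real x) = eta_ext 2 (of_real x)"
    using assms by (intro eta_eq_eta_ext) auto
  also have "\<dots> = of_real c"
    using D1[of 0] by (simp add: eta_ext_def tail c_def lessThan_nat_numeral)
  finally have "eta (of_real x) = of_real c" .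
  moreover have "c > 0"
    using lower by (simp add: c_def)
  ultimately show ?thesis
    using that by blast
qed

section \<open>Zeta as a quotient of eta\<close>

text \<open>The modulus is 2 to the power 1 - Re s, so the denominator of \<open>zeta_ext\<close>
  can vanish only on the line Re s = 1.\<close>

lemma two_powr_ne_1:
  assumes "Re s \<noteq> 1"
  shows "(2 :: complex) powr (1 - s) \<noteq> 1"
proof
  assume "(2 :: complex) powr (1 - s) = 1"
  then have "(2 :: real) powr (1 - Re s) = 1"
    using norm_powr_real_powr[of 2 "1 - s"] by simp
  with assms show False
    by (simp add: powr_eq_one_iff_gen)
qed

text \<open>
  The quotient has removable singularities at \<open>1 + 2 \<pi> i k / ln 2\<close> for \<open>k \<noteq> 0\<close>,
  where division by zero yields the junk value \<open>0\<close>.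
\<close>

definition zeta_ext :: "complex \<Rightarrow> complex" where
  "zeta_ext s = eta s / (1 - 2 powr (1 - s))"

lemma zeta_ext_sums:
  assumes "Re s > 1"
  shows "(\<lambda>n. of_nat (Suc n) powr (- s)) sums zeta_ext s"
proof -
  define f where "f = (\<lambda>n. complex_of_nat (Suc n) powr (- s))"
  have pd: "powr_fdiff 0 s (real n + 1) = f n" for n
    by (simp add: f_def add.commute)
  have nf: "norm (f n) = (real n + 1) powr (- Re s)" for n
    unfolding f_def using norm_powr_real_powr[of "of_nat (Suc n)" "- s"] by (simp add: add.commute)
  have "summable f"
    by (rule summable_norm_cancel) (use assms in \<open>simp add: nf summable_Suc_powr\<close>)
  then obtain Z where Z: "f sums Z"
    by (auto simp: summable_def)
  have "(\<lambda>n. (- 1) ^ n * f n) sums eta_tail 0 s"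
    unfolding eta_tail_def using summable_sums[OF summable_powr_fdiff[of s 0]] assms
    by (simp only: pd)
  also have "eta_tail 0 s = eta s"
    using eta_eq_eta_ext[of s 0] assms by (simp add: eta_ext_def)
  \<comment> \<open>Index \<open>i\<close> stands for the integer i + 1. In the difference of the
    two series each pair leaves only twice the term of the even integer 2 (n + 1), so grouping
    aligns it with \<open>f n\<close>.\<close>
  finally have "(\<lambda>n. \<Sum>i\<in>{n*2..<n*2+2}. (- 1) ^ i * f i) sums eta s"
    by (rule sums_group) simp
  moreover have "(\<lambda>n. \<Sum>i\<in>{n*2..<n*2+2}. f i) sums Z"
    using Z by (rule sums_group) simp
  ultimately have "(\<lambda>n. (\<Sum>i\<in>{n*2..<n*2+2}. f i) - (\<Sum>i\<in>{n*2..<n*2+2}. (- 1) ^ i * f i))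
      sums (Z - eta s)"
    by (intro sums_diff)
  also have "(\<lambda>n. (\<Sum>i\<in>{n*2..<n*2+2}. f i) - (\<Sum>i\<in>{n*2..<n*2+2}. (- 1) ^ i * f i))
      = (\<lambda>n. 2 powr (1 - s) * f n)"
  proof
    fix n
    have "f (Suc (n * 2)) = (of_real 2 * of_real (real (Suc n))) powr (- s)"
      by (simp add: f_def algebra_simps)
    also have "\<dots> = 2 powr (- s) * f n"
      by (subst powr_times_real) (auto simp: f_def)
    finally have "2 * f (Suc (n * 2)) = 2 powr (1 - s) * f n"
      by (simp add: powr_diff powr_minus divide_inverse)
    then show "(\<Sum>i\<in>{n*2..<n*2+2}. f i) - (\<Sum>i\<in>{n*2..<n*2+2}. (- 1) ^ i * f i)
        = 2 powr (1 - s) * f n"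
      by simp
  qed
  finally have "2 powr (1 - s) * Z = Z - eta s"
    using sums_mult[OF Z, of "2 powr (1 - s)"] sums_unique2 by blast
  then have "eta s = (1 - 2 powr (1 - s)) * Z"
    by (simp add: algebra_simps)
  then have "zeta_ext s = Z"
    using two_powr_ne_1[of s] assms by (simp add: zeta_ext_def)
  with Z show ?thesis
    by (simp add: f_def)
qed

lemma zeta_ext_of_real_neg:
  assumes "0 \<le> x" "x < 1"
  obtains c where "c < 0" "zeta_ext (complex_of_real x) = of_real c"
proof -
  obtain e where e: "e > 0" "eta (complex_of_real x) = of_real e"
    using eta_of_real_pos assms by blast
  have "complex_of_real 2 powr of_real (1 - x) = of_real (2 powr (1 - x))"
    by (subst powr_of_real) auto
  then have "zeta_ext (of_real x) = of_real (e / (1 - 2 powr (1 - x)))"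
    by (simp add: zeta_ext_def e)
  moreover have "(2 :: real) powr (1 - x) > 1"
    using assms powr_less_mono[of 0 "1 - x" 2] by simp
  then have "e / (1 - 2 powr (1 - x)) < 0"
    using e by (simp add: divide_pos_neg)
  ultimately show ?thesis
    using that by blast
qed

text \<open>The hypothesis keeps \<open>c * s\<close> off the line containing every zero of the
  denominator: the pole as well as the removable singularities.\<close>

lemma zeta_ext_mult_analytic:
  assumes "Re (c * s) \<noteq> 1"
  shows "(\<lambda>z. zeta_ext (c * z)) analytic_on {s}"
proof -
  have "eta analytic_on UNIV"
    using holomorphic_eta by (simp add: analytic_on_open)
  then have "(\<lambda>z. eta (c * z)) analytic_on {s}"
    by (intro analytic_on_compose_gen[of "\<lambda>z. c * z" _ eta UNIV, unfolded o_def])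
      (auto intro!: analytic_intros)
  moreover have "(\<lambda>z. 1 - 2 powr (1 - c * z)) analytic_on {s}"
    by (intro analytic_intros) auto
  ultimately show ?thesis
    unfolding zeta_ext_def using two_powr_ne_1[OF assms]
    by (intro analytic_on_divide) auto
qed

lemma zeta_ext_mult_meromorphic: "(\<lambda>z. zeta_ext (c * z)) meromorphic_on UNIV"
proof -
  have "(\<lambda>z. eta (c * z)) analytic_on UNIV"
    using holomorphic_eta
    by (intro analytic_on_compose_gen[of "\<lambda>z. c * z" _ eta UNIV, unfolded o_def])
      (auto intro!: analytic_intros simp: analytic_on_open)
  moreover have "(\<lambda>z. 1 - 2 powr (1 - c * z)) analytic_on UNIV"
    by (intro analytic_intros) auto
  ultimately show ?thesis
    unfolding zeta_ext_def by (intro meromorphic_on_divide analytic_on_imp_meromorphic_on)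
qed

subsection \<open>Elementary symmetric functions and the Euler--Zagier series\<close>

text \<open>Generating polynomial whose coefficient of degree r is the r-th elementary symmetric
  polynomial in \<open>x 1\<close>, ..., \<open>x N\<close>.\<close>

definition elem_sym_fps :: "(nat \<Rightarrow> 'a :: field) \<Rightarrow> nat \<Rightarrow> 'a fps" where
  "elem_sym_fps x N = (\<Prod>m\<in>{1..N}. 1 + fps_const (x m) * fps_X)"

lemma elem_sym_fps_Suc:
  "elem_sym_fps x (Suc N) = elem_sym_fps x N * (1 + fps_const (x (Suc N)) * fps_X)"
  by (simp add: elem_sym_fps_def)

lemma elem_sym_fps_nth_0 [simp]: "elem_sym_fps x N $ 0 = 1"
  by (induction N) (simp_all add: elem_sym_fps_def)

lemma elem_sym_fps_0_nth_Suc [simp]: "elem_sym_fps x 0 $ Suc r = 0"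
  by (simp add: elem_sym_fps_def)

lemma elem_sym_fps_Suc_nth_Suc:
  "elem_sym_fps x (Suc N) $ Suc r = elem_sym_fps x N $ Suc r + x (Suc N) * elem_sym_fps x N $ r"
proof -
  have "elem_sym_fps x (Suc N) = elem_sym_fps x N + fps_const (x (Suc N)) * (elem_sym_fps x N * fps_X)"
    by (simp add: elem_sym_fps_Suc algebra_simps)
  then show ?thesis
    by simp
qed

text \<open>This is the logarithmic derivative: the geometric expansions of x_m / (1 + x_m X) add up
  to the generating series of the signed power sums.\<close>

lemma fps_deriv_elem_sym_fps:
  fixes x :: "nat \<Rightarrow> 'a :: field"
  shows "fps_deriv (elem_sym_fps x N)
    = elem_sym_fps x N * Abs_fps (\<lambda>k. (- 1) ^ k * (\<Sum>m\<in>{1..N}. x m ^ Suc k))"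
proof (induction N)
  case 0
  have "Abs_fps (\<lambda>k. 0 :: 'a) = 0"
    by (simp add: fps_ext)
  then show ?case by (simp add: elem_sym_fps_def)
next
  case (Suc N)
  define P where "P = (\<lambda>N. Abs_fps (\<lambda>k. (- 1) ^ k * (\<Sum>m\<in>{1..N}. x m ^ Suc k)))"
  \<comment> \<open>The geometric series for the new factor, characterised below by its product with
    that factor, without division.\<close>
  define Q where "Q = Abs_fps (\<lambda>k. (- 1) ^ k * x (Suc N) ^ Suc k)"
  have PQ: "P (Suc N) = P N + Q"
    by (rule fps_ext) (simp add: P_def Q_def algebra_simps)
  have "(1 + fps_const (x (Suc N)) * fps_X) * Q = Q + fps_const (x (Suc N)) * (fps_X * Q)"
    by (simp add: algebra_simps)
  also have "\<dots> = fps_const (x (Suc N))"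
  proof (rule fps_ext)
    show "(Q + fps_const (x (Suc N)) * (fps_X * Q)) $ n = fps_const (x (Suc N)) $ n" for n
      by (cases n) (simp_all add: Q_def)
  qed
  finally have Q: "(1 + fps_const (x (Suc N)) * fps_X) * Q = fps_const (x (Suc N))" .
  have "fps_deriv (elem_sym_fps x (Suc N))
      = elem_sym_fps x N * fps_const (x (Suc N))
        + elem_sym_fps x N * P N * (1 + fps_const (x (Suc N)) * fps_X)"
    using Suc.IH by (simp add: elem_sym_fps_Suc P_def)
  also have "elem_sym_fps x N * fps_const (x (Suc N))
      = elem_sym_fps x N * ((1 + fps_const (x (Suc N)) * fps_X) * Q)"
    by (simp only: Q)
  also have "\<dots> + elem_sym_fps x N * P N * (1 + fps_const (x (Suc N)) * fps_X)
      = elem_sym_fps x (Suc N) * P (Suc N)"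
    unfolding PQ elem_sym_fps_Suc by (simp only: algebra_simps)
  finally show ?case
    by (simp only: P_def)
qed

lemma newton_identity:
  fixes x :: "nat \<Rightarrow> 'a :: field"
  shows "of_nat (Suc r) * elem_sym_fps x N $ Suc r
    = (\<Sum>k\<le>r. (- 1) ^ k * elem_sym_fps x N $ (r - k) * (\<Sum>m\<in>{1..N}. x m ^ Suc k))"
proof -
  have "of_nat (Suc r) * elem_sym_fps x N $ Suc r = fps_deriv (elem_sym_fps x N) $ r"
    by simp
  also have "\<dots> = (Abs_fps (\<lambda>k. (- 1) ^ k * (\<Sum>m\<in>{1..N}. x m ^ Suc k)) * elem_sym_fps x N) $ r"
    by (simp only: fps_deriv_elem_sym_fps mult.commute)
  also have "\<dots> = (\<Sum>k\<le>r. (- 1) ^ k * elem_sym_fps x N $ (r - k) * (\<Sum>m\<in>{1..N}. x m ^ Suc k))"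
    unfolding fps_mult_nth by (intro sum.cong) (auto simp: mult_ac)
  finally show ?thesis .
qed

text \<open>Expanding the power produces each squarefree product among nonnegative terms. The bound
  later gives absolute convergence of \<open>ez_series\<close>.\<close>

lemma elem_sym_fps_le_power:
  fixes x :: "nat \<Rightarrow> real"
  assumes "\<And>m. x m \<ge> 0"
  shows "elem_sym_fps x N $ r \<le> (\<Sum>m\<in>{1..N}. x m) ^ r"
proof (induction N arbitrary: r)
  case 0
  show ?case by (cases r) simp_all
next
  case (Suc N)
  define p where "p = (\<Sum>m\<in>{1..N}. x m)"
  have p: "p \<ge> 0"
    using assms by (simp add: p_def sum_nonneg)
  show ?case
  proof (cases r)
    case (Suc q)
    have "elem_sym_fps x (Suc N) $ r \<le> p ^ Suc q + x (Suc N) * p ^ q"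
      unfolding Suc elem_sym_fps_Suc_nth_Suc p_def
      using assms by (intro add_mono mult_left_mono Suc.IH)
    also have "\<dots> = (p + x (Suc N)) * p ^ q"
      by (simp add: algebra_simps)
    also have "\<dots> \<le> (p + x (Suc N)) * (p + x (Suc N)) ^ q"
      using assms p by (intro mult_left_mono power_mono) auto
    finally show ?thesis
      by (simp add: Suc p_def)
  qed simp
qed

section \<open>Truncated tuple sums and their limit\<close>

definition ez_tuples_upto :: "nat \<Rightarrow> nat \<Rightarrow> nat list set" where
  "ez_tuples_upto r N = {ms \<in> ez_tuples r. set ms \<subseteq> {..N}}"

lemma finite_ez_tuples_upto: "finite (ez_tuples_upto r N)"
  by (rule finite_subset[OF _ finite_lists_length_eq[of "{..N}" r]])
    (auto simp: ez_tuples_upto_def ez_tuples_def)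

lemma ez_tuples_upto_0_length [simp]: "ez_tuples_upto 0 N = {[]}"
  by (auto simp: ez_tuples_upto_def ez_tuples_def)

lemma ez_tuples_upto_Suc_0 [simp]: "ez_tuples_upto (Suc r) 0 = {}"
  by (auto simp: ez_tuples_upto_def ez_tuples_def length_Suc_conv)

text \<open>The last entry is the largest, so either it equals \<open>Suc N\<close> or all entries
  are at most \<open>N\<close>. This matches the recursion
  \<open>elem_sym_fps_Suc_nth_Suc\<close>.\<close>

lemma ez_tuples_upto_Suc_Suc:
  "ez_tuples_upto (Suc r) (Suc N)
    = ez_tuples_upto (Suc r) N \<union> (\<lambda>ms. ms @ [Suc N]) ` ez_tuples_upto r N"
proof (intro equalityI subsetI)
  fix ms assume ms: "ms \<in> ez_tuples_upto (Suc r) (Suc N)"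
  then obtain ns n where ns: "ms = ns @ [n]"
    by (cases ms rule: rev_cases) (auto simp: ez_tuples_upto_def ez_tuples_def)
  show "ms \<in> ez_tuples_upto (Suc r) N \<union> (\<lambda>ms. ms @ [Suc N]) ` ez_tuples_upto r N"
  proof (cases "n = Suc N")
    case True
    then have "ns \<in> ez_tuples_upto r N"
      using ms ns by (fastforce simp: ez_tuples_upto_def ez_tuples_def sorted_wrt_append)
    then show ?thesis
      using ns True by blast
  next
    case False
    then have "ms \<in> ez_tuples_upto (Suc r) N"
      using ms ns by (fastforce simp: ez_tuples_upto_def ez_tuples_def sorted_wrt_append)
    then show ?thesis
      by blast
  qed
next
  fix ms assume "ms \<in> ez_tuples_upto (Suc r) N \<union> (\<lambda>ms. ms @ [Suc N]) ` ez_tuples_upto r N"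
  then show "ms \<in> ez_tuples_upto (Suc r) (Suc N)"
    by (fastforce simp: ez_tuples_upto_def ez_tuples_def sorted_wrt_append)
qed

lemma sum_ez_tuples_upto:
  "(\<Sum>ms\<in>ez_tuples_upto r N. \<Prod>m\<leftarrow>ms. x m) = elem_sym_fps x N $ r"
proof (induction N arbitrary: r)
  case 0
  show ?case by (cases r) simp_all
next
  case (Suc N)
  show ?case
  proof (cases r)
    case (Suc q)
    have "ez_tuples_upto (Suc q) N \<inter> (\<lambda>ms. ms @ [Suc N]) ` ez_tuples_upto q N = {}"
      by (auto simp: ez_tuples_upto_def)
    then have "(\<Sum>ms\<in>ez_tuples_upto r (Suc N). \<Prod>m\<leftarrow>ms. x m)
        = (\<Sum>ms\<in>ez_tuples_upto (Suc q) N. \<Prod>m\<leftarrow>ms. x m)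
          + (\<Sum>ms\<in>(\<lambda>ms. ms @ [Suc N]) ` ez_tuples_upto q N. \<Prod>m\<leftarrow>ms. x m)"
      unfolding Suc ez_tuples_upto_Suc_Suc
      by (intro sum.union_disjoint finite_imageI finite_ez_tuples_upto)
    also have "(\<Sum>ms\<in>(\<lambda>ms. ms @ [Suc N]) ` ez_tuples_upto q N. \<Prod>m\<leftarrow>ms. x m)
        = (\<Sum>ms\<in>ez_tuples_upto q N. (\<Prod>m\<leftarrow>ms. x m) * x (Suc N))"
      by (subst sum.reindex) (auto simp: inj_on_def)
    finally show ?thesis
      unfolding sum_distrib_right [symmetric] Suc.IH
      by (simp add: Suc elem_sym_fps_Suc_nth_Suc mult.commute)
  qed simp
qed

text \<open>Lets the unordered infinite sum be computed as a sequential limit of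
  truncations.\<close>

lemma ez_tuples_upto_filterlim:
  "filterlim (ez_tuples_upto r) (finite_subsets_at_top (ez_tuples r)) sequentially"
  unfolding filterlim_finite_subsets_at_top
proof (intro allI impI)
  fix X assume X: "finite X \<and> X \<subseteq> ez_tuples r"
  have "finite (\<Union>ms\<in>X. set ms)"
    using X by blast
  then obtain M where M: "\<And>ms m. ms \<in> X \<Longrightarrow> m \<in> set ms \<Longrightarrow> m \<le> M"
    unfolding finite_nat_set_iff_bounded_le by blast
  have "X \<subseteq> ez_tuples_upto r N" if "N \<ge> M" for N
    using that M X by (fastforce simp: ez_tuples_upto_def)
  then show "\<forall>\<^sub>F N in sequentially. finite (ez_tuples_upto r N) \<and> X \<subseteq> ez_tuples_upto r N
      \<and> ez_tuples_upto r N \<subseteq> ez_tuples r"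
    unfolding eventually_sequentially
    by (intro exI[of _ M]) (auto simp: finite_ez_tuples_upto, auto simp: ez_tuples_upto_def)
qed

lemma of_nat_prod_list_powr:
  "(of_nat (prod_list ms) :: complex) powr s = (\<Prod>m\<leftarrow>ms. of_nat m powr s)"
proof (induction ms)
  case (Cons m ms)
  have "of_nat (prod_list (m # ms)) powr s
      = (complex_of_real (real m) * complex_of_real (real (prod_list ms))) powr s"
    by simp
  also have "\<dots> = of_nat m powr s * of_nat (prod_list ms) powr s"
    by (subst powr_times_real) simp_all
  finally show ?case
    using Cons.IH by simp
qed simp

lemma norm_of_nat_powr: "norm (of_nat m powr s :: complex) = real m powr Re s"
  using norm_powr_real_powr[of "of_nat m" s] by simp

lemma ez_series_limit:
  assumes "Re s > 1"
  shows "(\<lambda>N. elem_sym_fps (\<lambda>m. of_nat m powr (- s)) N $ r) \<longlonglongrightarrow> ez_series r s"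
proof -
  define f where "f = (\<lambda>ms. of_nat (prod_list ms) powr (- s) :: complex)"
  define x where "x = (\<lambda>m. real m powr (- Re s))"
  \<comment> \<open>Since \<open>0 powr a = 0\<close>, the term at m = 0 vanishes and
    \<open>B\<close> is zeta at \<open>Re s\<close>.\<close>
  define B where "B = (\<Sum>m. x m)"
  have x: "summable x"
    unfolding x_def using assms by (simp add: summable_real_powr_iff)
  have x_nonneg: "x m \<ge> 0" for m
    by (simp add: x_def)
  have nf: "norm (f ms) = (\<Prod>m\<leftarrow>ms. x m)" for ms
    unfolding f_def of_nat_prod_list_powr
    by (induction ms) (simp_all add: norm_mult norm_of_nat_powr x_def)
  have "sum (\<lambda>ms. norm (f ms)) F \<le> B ^ r" if F: "F \<subseteq> ez_tuples r" "finite F" for F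
  proof -
    have "\<forall>\<^sub>F N in sequentially. finite (ez_tuples_upto r N) \<and> F \<subseteq> ez_tuples_upto r N
        \<and> ez_tuples_upto r N \<subseteq> ez_tuples r"
      using ez_tuples_upto_filterlim[of r] F unfolding filterlim_finite_subsets_at_top by blast
    then obtain N where "F \<subseteq> ez_tuples_upto r N"
      by (auto simp: eventually_sequentially)
    then have "sum (\<lambda>ms. norm (f ms)) F \<le> sum (\<lambda>ms. norm (f ms)) (ez_tuples_upto r N)"
      by (intro sum_mono2 finite_ez_tuples_upto) auto
    also have "\<dots> = elem_sym_fps x N $ r"
      unfolding nf by (rule sum_ez_tuples_upto)
    also have "\<dots> \<le> (\<Sum>m\<in>{1..N}. x m) ^ r"
      by (rule elem_sym_fps_le_power) (rule x_nonneg)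
    also have "\<dots> \<le> B ^ r"
      unfolding B_def using x x_nonneg by (intro power_mono sum_le_suminf sum_nonneg) auto
    finally show ?thesis .
  qed
  then have "(\<lambda>ms. norm (f ms)) summable_on ez_tuples r"
    by (intro nonneg_bdd_above_summable_on bdd_aboveI2[where M = "B ^ r"]) auto
  then have "f summable_on ez_tuples r"
    by (rule abs_summable_summable)
  then have "(f has_sum ez_series r s) (ez_tuples r)"
    unfolding ez_series_def f_def by (rule has_sum_infsum)
  then have "(\<lambda>N. sum f (ez_tuples_upto r N)) \<longlonglongrightarrow> ez_series r s"
    unfolding has_sum_def by (rule filterlim_compose) (rule ez_tuples_upto_filterlim)
  then show ?thesis
    unfolding f_def of_nat_prod_list_powr sum_ez_tuples_upto .
qed

lemma ez_series_0: "ez_series 0 s = 1"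
proof -
  have "ez_tuples 0 = {[]}"
    by (auto simp: ez_tuples_def)
  then show ?thesis
    by (simp add: ez_series_def)
qed

subsection \<open>Continuation by Newton's identities\<close>

text \<open>Newton's identities solved for the top index, with \<open>k\<close> shifted to start at
  0. Junk values inherited from \<open>zeta_ext\<close> are tolerated here and removed by
  \<open>remove_sings\<close> in \<open>ez_zeta_eq_ez_newton\<close>.\<close>

fun ez_newton :: "nat \<Rightarrow> complex \<Rightarrow> complex" where
  "ez_newton 0 s = 1"
| "ez_newton (Suc r) s =
    (\<Sum>k\<le>r. (- 1) ^ k * ez_newton (r - k) s * zeta_ext (of_nat (Suc k) * s)) / of_nat (Suc r)"

text \<open>The finite identity for the numbers m^(-s) with m \<le> N passes to the limit: the power
  sum of exponent k + 1 tends to zeta at (k + 1) s, which again has real part above 1.\<close>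

lemma ez_newton_eq_ez_series:
  assumes "Re s > 1"
  shows "ez_newton r s = ez_series r s"
proof (induction r rule: less_induct)
  case (less r)
  define x where "x = (\<lambda>m. of_nat m powr (- s) :: complex)"
  define e where "e = (\<lambda>N. elem_sym_fps x N)"
  have e: "(\<lambda>N. e N $ q) \<longlonglongrightarrow> ez_series q s" for q
    unfolding e_def x_def using assms by (rule ez_series_limit)
  have p: "(\<lambda>N. \<Sum>m\<in>{1..N}. x m ^ Suc k) \<longlonglongrightarrow> zeta_ext (of_nat (Suc k) * s)" for k
  proof -
    have "1 * Re s \<le> real (Suc k) * Re s"
      using assms by (intro mult_right_mono) auto
    with assms have "1 < real (Suc k) * Re s"
      by linarith
    then have "1 < Re (of_nat (Suc k) * s)"
      by simp
    then have "(\<lambda>N. \<Sum>n<N. of_nat (Suc n) powr (- (of_nat (Suc k) * s)))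
        \<longlonglongrightarrow> zeta_ext (of_nat (Suc k) * s)"
      using zeta_ext_sums unfolding sums_def by blast
    moreover have "(\<Sum>n<N. of_nat (Suc n) powr (- (of_nat (Suc k) * s)))
        = (\<Sum>m\<in>{1..N}. x m ^ Suc k)" for N
      by (rule sum.reindex_bij_witness[of _ "\<lambda>m. m - 1" Suc])
        (auto simp: x_def powr_power simp del: of_nat_Suc power_Suc)
    ultimately show ?thesis
      by simp
  qed
  show ?case
  proof (cases r)
    case 0
    then show ?thesis by (simp add: ez_series_0)
  next
    case (Suc q)
    have "(\<lambda>N. \<Sum>k\<le>q. (- 1) ^ k * e N $ (q - k) * (\<Sum>m\<in>{1..N}. x m ^ Suc k))
        \<longlonglongrightarrow> (\<Sum>k\<le>q. (- 1) ^ k * ez_series (q - k) s * zeta_ext (of_nat (Suc k) * s))"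
      by (intro tendsto_intros e p)
    then have "(\<lambda>N. of_nat (Suc q) * e N $ Suc q)
        \<longlonglongrightarrow> (\<Sum>k\<le>q. (- 1) ^ k * ez_series (q - k) s * zeta_ext (of_nat (Suc k) * s))"
      unfolding e_def newton_identity .
    moreover have "(\<lambda>N. of_nat (Suc q) * e N $ Suc q) \<longlonglongrightarrow> of_nat (Suc q) * ez_series (Suc q) s"
      by (intro tendsto_intros e)
    ultimately have "of_nat (Suc q) * ez_series (Suc q) s
        = (\<Sum>k\<le>q. (- 1) ^ k * ez_series (q - k) s * zeta_ext (of_nat (Suc k) * s))"
      using LIMSEQ_unique by blast
    also have "\<dots> = (\<Sum>k\<le>q. (- 1) ^ k * ez_newton (q - k) s * zeta_ext (of_nat (Suc k) * s))"
      using less.IH by (simp add: Suc)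
    also have "\<dots> = of_nat (Suc q) * ez_newton (Suc q) s"
      by (simp del: of_nat_Suc)
    finally show ?thesis
      by (simp add: Suc del: of_nat_Suc ez_newton.simps)
  qed
qed

lemma ez_newton_meromorphic: "ez_newton r meromorphic_on UNIV"
proof (induction r rule: less_induct)
  case (less r)
  show ?case
  proof (cases r)
    case (Suc q)
    have "(\<lambda>s. (\<Sum>k\<le>q. (- 1) ^ k * ez_newton (q - k) s * zeta_ext (of_nat (Suc k) * s))
        / of_nat (Suc q)) meromorphic_on UNIV"
      by (intro meromorphic_intros zeta_ext_mult_meromorphic less.IH) (simp add: Suc)
    then show ?thesis
      by (simp add: Suc)
  qed (simp add: meromorphic_on_const)
qed

lemma ez_newton_analytic:
  assumes "\<And>k. 1 \<le> k \<Longrightarrow> k \<le> r \<Longrightarrow> real k * Re s \<noteq> 1"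
  shows "ez_newton r analytic_on {s}"
  using assms
proof (induction r rule: less_induct)
  case (less r)
  show ?case
  proof (cases r)
    case (Suc q)
    have "(\<lambda>s. zeta_ext (of_nat (Suc k) * s)) analytic_on {s}" if "k \<le> q" for k
      using less.prems[of "Suc k"] that by (intro zeta_ext_mult_analytic) (simp add: Suc)
    moreover have "ez_newton (q - k) analytic_on {s}" for k
      using less.prems by (intro less.IH) (auto simp: Suc)
    ultimately have "(\<lambda>s. (\<Sum>k\<le>q. (- 1) ^ k * ez_newton (q - k) s
        * zeta_ext (of_nat (Suc k) * s)) / of_nat (Suc q)) analytic_on {s}"
      by (intro analytic_intros) (auto simp del: of_nat_Suc)
    then show ?thesis
      by (simp add: Suc)
  qed simp
qed

text \<open>By uniqueness the continuation is \<open>remove_sings (ez_newton r)\<close>, and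
  removing singularities changes nothing at a point of analyticity.\<close>

lemma ez_zeta_eq_ez_newton:
  assumes "\<And>k. 1 \<le> k \<Longrightarrow> k \<le> r \<Longrightarrow> real k * Re s \<noteq> 1"
  shows "ez_zeta r s = ez_newton r s"
proof -
  have "is_ez_continuation r (remove_sings (ez_newton r))"
    unfolding is_ez_continuation_def
  proof (intro conjI allI impI)
    show "remove_sings (ez_newton r) nicely_meromorphic_on UNIV"
      using ez_newton_meromorphic by (rule remove_sings_nicely_meromorphic)
    fix z :: complex assume z: "1 < Re z"
    have "real k * Re z \<noteq> 1" if "1 \<le> k" for k
    proof -
      have "1 * Re z \<le> real k * Re z"
        using z that by (intro mult_right_mono) auto
      with z show ?thesis
        by linarith
    qed
    then have "ez_newton r analytic_on {z}"
      by (intro ez_newton_analytic)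
    then show "remove_sings (ez_newton r) z = ez_series r z"
      using ez_newton_eq_ez_series[OF z] by simp
  qed
  then have "ez_zeta r = remove_sings (ez_newton r)"
    unfolding ez_zeta_def using is_ez_continuation_unique by (intro the_equality)
  moreover have "ez_newton r analytic_on {s}"
    using assms by (rule ez_newton_analytic)
  ultimately show ?thesis
    by simp
qed

section \<open>The sign on the interval\<close>

text \<open>The signs (-1)^k and (-1)^(r - 1 - k) multiply to (-1)^(r - 1), and the negative zeta
  factor supplies one more, so all summands share the sign (-1)^r and cannot cancel.\<close>

lemma ez_newton_sign:
  assumes "0 \<le> s" "real r * s < 1"
  shows "\<exists>c>0. ez_newton r (complex_of_real s) = of_real ((- 1) ^ r * c)"
  using assms(2)
proof (induction r rule: less_induct)
  case (less r)
  show ?case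
  proof (cases r)
    case 0
    then show ?thesis by (auto intro!: exI[of _ 1])
  next
    case (Suc q)
    have small: "real k * s < 1" if "k \<le> r" for k
      using that less.prems assms(1) mult_right_mono[of "real k" "real r" s] by simp
    have "\<exists>c>0. ez_newton (q - k) (of_real s) = of_real ((- 1) ^ (q - k) * c)" for k
      by (intro less.IH small) (simp_all add: Suc)
    then obtain c where c: "\<And>k. c k > 0"
      "\<And>k. ez_newton (q - k) (of_real s) = of_real ((- 1) ^ (q - k) * c k)"
      by metis
    have "\<exists>z<0. zeta_ext (of_nat (Suc k) * of_real s) = of_real z" if "k \<le> q" for k
      using zeta_ext_of_real_neg[of "real (Suc k) * s"] small[of "Suc k"] that assms(1)
      by (auto simp: Suc)
    then obtain z where z: "\<And>k. k \<le> q \<Longrightarrow> z k < 0"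
      "\<And>k. k \<le> q \<Longrightarrow> zeta_ext (of_nat (Suc k) * of_real s) = of_real (z k)"
      by metis
    define C where "C = (\<Sum>k\<le>q. c k * (- z k)) / real (Suc q)"
    have "(\<Sum>k\<le>q. c k * (- z k)) > 0"
      using c(1) z(1) by (intro sum_pos mult_pos_pos) auto
    then have "C > 0"
      by (simp add: C_def)
    have "(- 1) ^ k * ez_newton (q - k) (of_real s) * zeta_ext (of_nat (Suc k) * of_real s)
        = of_real ((- 1) ^ Suc q * (c k * (- z k)))" if "k \<le> q" for k
    proof -
      have "(- 1) ^ k * (- 1) ^ (q - k) = (- 1 :: real) ^ q"
        using that by (simp add: power_add [symmetric])
      then have "(- 1) ^ k * ((- 1) ^ (q - k) * c k) * z k = (- 1) ^ Suc q * (c k * (- z k))"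
        by (simp add: mult.assoc [symmetric])
      then have "complex_of_real ((- 1) ^ k * ((- 1) ^ (q - k) * c k) * z k)
          = of_real ((- 1) ^ Suc q * (c k * (- z k)))"
        by (simp only:)
      then show ?thesis
        unfolding c z(2)[OF that] by simp
    qed
    then have "ez_newton r (of_real s)
        = (\<Sum>k\<le>q. of_real ((- 1) ^ Suc q * (c k * (- z k)))) / of_nat (Suc q)"
      unfolding Suc ez_newton.simps by (intro arg_cong2[of _ _ _ _ "(/)"] sum.cong) auto
    also have "\<dots> = of_real ((- 1) ^ r * C)"
      unfolding C_def Suc of_real_sum [symmetric] sum_distrib_left [symmetric] by simp
    finally show ?thesis
      using \<open>C > 0\<close> by blast
  qed
qed

theorem theorem1:
  fixes r :: nat and s :: real
  assumes "1 \<le> r" and "0 \<le> s" and "s < 1 / real r"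
  shows "ez_zeta r (complex_of_real s) \<in> \<real> \<and>
    (even r \<longrightarrow> 0 < Re (ez_zeta r (complex_of_real s))) \<and>
    (odd r \<longrightarrow> Re (ez_zeta r (complex_of_real s)) < 0) \<and>
    ez_zeta r (complex_of_real s) \<noteq> 0"
proof -
  have rs: "real r * s < 1"
    using assms by (simp add: field_simps)
  have "real k * s \<noteq> 1" if "k \<le> r" for k
    using that rs assms(2) mult_right_mono[of "real k" "real r" s] by simp
  then have "ez_zeta r (complex_of_real s) = ez_newton r (complex_of_real s)"
    by (intro ez_zeta_eq_ez_newton) simp
  moreover obtain c where "c > 0" "ez_newton r (complex_of_real s) = of_real ((- 1) ^ r * c)"
    using ez_newton_sign[OF assms(2) rs] by blast
  ultimately show ?thesis
    by (cases "even r") auto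
qed

end
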